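(* Let $G$ be a graph. (a) If $\lambda(G)\ge 5$, then $G$ contains a spanning $3$-partite 2T-subgraph. (b) If $\lambda(G)\ge 7$, then $G$ contains a spanning bipartite 2T-subgraph.
   Context: Graphs are finite, undirected, without loops or multiple edges. The edge-connectivity $\lambda(G)$ is the minimum, over non-empty proper subsets $X\subset V(G)$, of the number of edges with exactly one end-vertex in $X$. A 2T-graph is a graph whose edge set decomposes into (the edge sets of) two edge-disjoint spanning trees. A spanning 2T-subgraph of $G$ is a subgraph $H$ with $V(H)=V(G)$ that is a 2T-graph. A graph is $k$-partite if its vertex set can be partitioned into $k$ (possibly empty) independent sets; bipartite means $2$-partite. *)

theory Defs
  imports
    "Graph_Theory.Digraph_Component"
    "HOL-Library.Extended_Nat"
    "HOL-Library.Disjoint_Sets"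
begin

text \<open>
  A finite simple undirected graph is an instance of the AFP locale \<open>graph\<close>: a finite loop-free
  symmetric digraph without parallel arcs. An undirected edge is represented by the two opposite
  arcs joining its end-vertices, so edges are always counted in \<open>uedges\<close>, not in \<open>arcs\<close>.
\<close>

definition uedges :: "('a, 'b) pre_digraph \<Rightarrow> 'a set set" where
  "uedges G = (\<lambda>e. {tail G e, head G e}) ` arcs G"

definition edge_cut :: "('a, 'b) pre_digraph \<Rightarrow> 'a set \<Rightarrow> 'a set set" where
  "edge_cut G X = {e \<in> uedges G. card (e \<inter> X) = 1}"

text \<open>
  If \<open>G\<close> has a single vertex, there is no non-empty proper vertex subset and the value is
  \<open>\<infinity>\<close>.
\<close>

definition edge_connectivity :: "('a, 'b) pre_digraph \<Rightarrow> enat" where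
  "edge_connectivity G = (INF X \<in> {X. X \<noteq> {} \<and> X \<subset> verts G}. enat (card (edge_cut G X)))"

text \<open>
  The AFP predicates \<open>forest\<close>, \<open>tree\<close> and \<open>spanning_tree\<close> cannot be used: they count the closed walk
  \<open>u, v, u\<close> along an edge and its reverse as a cycle. In a symmetric digraph without loops and
  parallel arcs, the cycles of the undirected graph are exactly the directed cycles of length at
  least 3.
\<close>

definition undirected_tree :: "('a, 'b) pre_digraph \<Rightarrow> bool" where
  "undirected_tree T \<longleftrightarrow>
     graph T \<and> connected T \<and> \<not> (\<exists>p. pre_digraph.cycle T p \<and> 3 \<le> length p)"

definition undirected_spanning_tree ::
    "('a, 'b) pre_digraph \<Rightarrow> ('a, 'b) pre_digraph \<Rightarrow> bool" where
  "undirected_spanning_tree T G \<longleftrightarrow> undirected_tree T \<and> spanning T G"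

definition graph_2T :: "('a, 'b) pre_digraph \<Rightarrow> bool" where
  "graph_2T H \<longleftrightarrow> graph H \<and>
     (\<exists>T1 T2. undirected_spanning_tree T1 H \<and> undirected_spanning_tree T2 H \<and>
        uedges T1 \<inter> uedges T2 = {} \<and> uedges T1 \<union> uedges T2 = uedges H)"

definition spanning_2T_subgraph ::
    "('a, 'b) pre_digraph \<Rightarrow> ('a, 'b) pre_digraph \<Rightarrow> bool" where
  "spanning_2T_subgraph H G \<longleftrightarrow> spanning H G \<and> graph_2T H"

definition independent_set :: "('a, 'b) pre_digraph \<Rightarrow> 'a set \<Rightarrow> bool" where
  "independent_set G S \<longleftrightarrow> S \<subseteq> verts G \<and> (\<forall>e \<in> uedges G. \<not> e \<subseteq> S)"

definition k_partite :: "nat \<Rightarrow> ('a, 'b) pre_digraph \<Rightarrow> bool" where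
  "k_partite k G \<longleftrightarrow>
     (\<exists>P :: nat \<Rightarrow> 'a set. disjoint_family_on P {..<k} \<and> (\<Union>i<k. P i) = verts G \<and>
        (\<forall>i<k. independent_set G (P i)))"

abbreviation bipartite :: "('a, 'b) pre_digraph \<Rightarrow> bool" where
  "bipartite \<equiv> k_partite 2"

end

theory Submission
  imports Defs
begin

text \<open>
  Colour the vertices with \<open>k\<close> colours so that as many edges as possible are bichromatic. Rotating the
  colours cyclically on one side of a cut yields no improvement, so at most a \<open>1/k\<close> fraction of every
  cut is monochromatic. For \<open>k = 3\<close>, \<open>\<lambda> \<ge> 5\<close> and for \<open>k = 2\<close>, \<open>\<lambda> \<ge> 7\<close> the bichromatic edges thus form
  a 4-edge-connected \<open>k\<close>-partite graph, which has two edge-disjoint spanning trees by the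
  Nash-Williams--Tutte theorem. The latter is proved by an exchange argument for \<open>k\<close> edge-disjoint
  forests of maximum total size: every forest, restricted to the edges that some sequence of
  exchanges omits, already spans the components of these edges. Contracting the components leaves
  only edges used by the forests, and there are enough of them by edge-connectivity.
\<close>

section \<open>Connection along edge sets, and forests\<close>

definition joined :: "'a set set \<Rightarrow> 'a \<Rightarrow> 'a \<Rightarrow> bool" where
  "joined F x y \<longleftrightarrow> (x, y) \<in> {(u, v). {u, v} \<in> F}\<^sup>*"

text \<open>Acyclicity in the form "every edge is a bridge", which avoids walks and cycles. As
  \<open>joined\<close> is reflexive, it also excludes singletons \<open>{u, u}\<close>.\<close>

definition edge_forest :: "'a set set \<Rightarrow> bool" where
  "edge_forest F \<longleftrightarrow> (\<forall>u v. {u, v} \<in> F \<longrightarrow> \<not> joined (F - {{u, v}}) u v)"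

lemma joined_refl [simp]: "joined F x x"
  by (simp add: joined_def)

lemma joined_edge: "{x, y} \<in> F \<Longrightarrow> joined F x y"
  by (auto simp: joined_def)

lemma joined_trans: "joined F x y \<Longrightarrow> joined F y z \<Longrightarrow> joined F x z"
  by (auto simp: joined_def)

lemma joined_sym: "joined F x y \<Longrightarrow> joined F y x"
proof -
  have "sym {(u, v). {u, v} \<in> F}"
    by (auto simp: sym_def insert_commute)
  then show "joined F x y \<Longrightarrow> joined F y x"
    unfolding joined_def by (metis sym_rtrancl symD)
qed

lemma joined_induct [consumes 1, case_names refl step]:
  assumes "joined F x y" "P x" "\<And>u v. joined F x u \<Longrightarrow> {u, v} \<in> F \<Longrightarrow> P u \<Longrightarrow> P v"
  shows "P y"
  using assms(1) unfolding joined_def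
  by (induction rule: rtrancl_induct) (use assms in \<open>auto simp: joined_def\<close>)

lemma joined_closure:
  assumes "joined F x y" "\<And>u v. {u, v} \<in> F \<Longrightarrow> joined F' u v"
  shows "joined F' x y"
  using assms(1) by (induction rule: joined_induct) (auto intro: joined_trans assms(2))

lemma joined_mono: "joined F x y \<Longrightarrow> F \<subseteq> F' \<Longrightarrow> joined F' x y"
  by (erule joined_closure) (auto intro: joined_edge)

text \<open>A connection that uses the new edge can be shortened to pass it once, in one of its two
  directions.\<close>

lemma joined_insert:
  "joined (insert {u, v} F) x y \<longleftrightarrow>
     joined F x y \<or> joined F x u \<and> joined F v y \<or> joined F x v \<and> joined F u y"
proof
  assume "joined (insert {u, v} F) x y"
  then show "joined F x y \<or> joined F x u \<and> joined F v y \<or> joined F x v \<and> joined F u y"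
  proof (induction rule: joined_induct)
    case (step a b)
    show ?case
    proof (cases "{a, b} = {u, v}")
      case True
      then have "a = u \<and> b = v \<or> a = v \<and> b = u"
        by (auto simp: doubleton_eq_iff)
      then show ?thesis
        using step.IH joined_refl joined_sym joined_trans by metis
    next
      case False
      then have "joined F a b"
        using step.hyps by (auto intro: joined_edge)
      then show ?thesis
        using step.IH joined_trans by metis
    qed
  qed simp
next
  let ?I = "insert {u, v} F"
  have "joined F a b \<Longrightarrow> joined ?I a b" for a b
    by (erule joined_mono) auto
  moreover have "joined ?I u v" "joined ?I v u"
    by (auto intro: joined_edge simp: insert_commute)
  ultimately show "joined F x y \<or> joined F x u \<and> joined F v y \<or> joined F x v \<and> joined F u y
      \<Longrightarrow> joined ?I x y"
    using joined_trans by metis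
qed

lemma edge_forest_subset:
  assumes "edge_forest F" "F' \<subseteq> F"
  shows "edge_forest F'"
  unfolding edge_forest_def
proof (intro allI impI notI)
  fix u v assume "{u, v} \<in> F'" "joined (F' - {{u, v}}) u v"
  moreover from this(2) have "joined (F - {{u, v}}) u v"
    by (rule joined_mono) (use assms in auto)
  ultimately show False
    using assms by (auto simp: edge_forest_def)
qed

text \<open>If an old edge \<open>{u, v}\<close> stopped being a bridge, the detour between its ends
  would use \<open>{x, y}\<close>; its remaining pieces together with \<open>{u, v}\<close> would
  already join \<open>x\<close> and \<open>y\<close> in \<open>F\<close>.\<close>

lemma edge_forest_insert:
  assumes "edge_forest F" "\<not> joined F x y"
  shows "edge_forest (insert {x, y} F)"
  unfolding edge_forest_def
proof (intro allI impI notI)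
  fix u v
  assume uv: "{u, v} \<in> insert {x, y} F" and j: "joined (insert {x, y} F - {{u, v}}) u v"
  show False
  proof (cases "{u, v} = {x, y}")
    case True
    then have "joined F u v"
      using j by (elim joined_mono) auto
    moreover have "u = x \<and> v = y \<or> u = y \<and> v = x"
      using True by (auto simp: doubleton_eq_iff)
    ultimately show False
      using assms(2) joined_sym by metis
  next
    case False
    let ?D = "F - {{u, v}}"
    have uvF: "{u, v} \<in> F"
      using uv False by simp
    have "insert {x, y} F - {{u, v}} = insert {x, y} ?D"
      using False by auto
    then have "joined ?D u v \<or> joined ?D u x \<and> joined ?D y v \<or> joined ?D u y \<and> joined ?D x v"
      using j by (simp add: joined_insert)
    moreover have "\<not> joined ?D u v"
      using assms(1) uvF by (simp add: edge_forest_def)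
    moreover have "joined ?D a b \<Longrightarrow> joined F a b" for a b
      by (erule joined_mono) auto
    ultimately have "joined F u x \<and> joined F y v \<or> joined F u y \<and> joined F x v"
      by blast
    then show False
      using assms(2) joined_edge[OF uvF] by (meson joined_sym joined_trans)
  qed
qed

text \<open>The edges of a forest whose removal separates \<open>x\<close> from \<open>y\<close> form the path from \<open>x\<close> to \<open>y\<close>.\<close>

lemma edge_forest_path:
  assumes "edge_forest F" "finite F" "F \<subseteq> {{u, v} | u v. True}" "joined F x y"
  shows "joined {f \<in> F. \<not> joined (F - {f}) x y} x y"
proof -
  define S where "S = {M. M \<subseteq> F \<and> joined M x y}"
  have "finite S"
    using assms(2) finite_subset[of S "Pow F"] by (auto simp: S_def)
  moreover have "F \<in> S"
    using assms(4) by (simp add: S_def)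
  ultimately obtain M where "M \<in> S" and min: "\<forall>M'\<in>S. M' \<subseteq> M \<longrightarrow> M = M'"
    using finite_has_minimal2[of S F] by blast
  then have MF: "M \<subseteq> F" and M: "joined M x y"
    by (simp_all add: S_def)
  \<comment> \<open>By minimality of \<open>M\<close>, deleting \<open>f\<close> leaves
    \<open>x\<close> connected to one end of \<open>f\<close> and \<open>y\<close> to the other.
    Another connection of \<open>x\<close> and \<open>y\<close> avoiding \<open>f\<close> would
    close these pieces to a detour around the bridge \<open>f\<close>.\<close>
  have "\<not> joined (F - {f}) x y" if f: "f \<in> M" for f
  proof
    assume j: "joined (F - {f}) x y"
    obtain u v where uv: "f = {u, v}"
      using f MF assms(3) by blast
    let ?D = "M - {f}"
    have "\<not> joined ?D x y"
      using bspec[OF min, of ?D] f MF by (auto simp: S_def)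
    moreover have "insert {u, v} ?D = M"
      using f uv by auto
    ultimately have "joined ?D x u \<and> joined ?D v y \<or> joined ?D x v \<and> joined ?D u y"
      using M joined_insert[of u v ?D x y] by metis
    moreover have "joined ?D a b \<Longrightarrow> joined (F - {f}) a b" for a b
      by (erule joined_mono) (use MF in auto)
    ultimately have "joined (F - {f}) x u \<and> joined (F - {f}) v y
        \<or> joined (F - {f}) x v \<and> joined (F - {f}) u y"
      by blast
    then have "joined (F - {f}) u v"
      using j by (meson joined_sym joined_trans)
    then show False
      using assms(1) subsetD[OF MF f] unfolding edge_forest_def uv by simp
  qed
  then have "M \<subseteq> {f \<in> F. \<not> joined (F - {f}) x y}"
    using MF by auto
  then show ?thesis
    by (rule joined_mono[OF M])
qed

section \<open>Components as joined classes\<close>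

definition joined_classes :: "'a set \<Rightarrow> 'a set set \<Rightarrow> 'a set set" where
  "joined_classes V F = (\<lambda>x. {y \<in> V. joined F x y}) ` V"

lemma joined_class_eq_iff:
  assumes "x \<in> V" "y \<in> V"
  shows "{z \<in> V. joined F x z} = {z \<in> V. joined F y z} \<longleftrightarrow> joined F x y"
  using assms by (auto dest: joined_sym joined_trans)

lemma joined_classes_cong:
  "(\<And>x y. joined F x y \<longleftrightarrow> joined F' x y) \<Longrightarrow> joined_classes V F = joined_classes V F'"
  by (simp add: joined_classes_def)

text \<open>The classes of \<open>u\<close> and \<open>v\<close> are replaced by their union; all
  others stay as they are.\<close>

lemma joined_classes_insert:
  assumes V: "u \<in> V" "v \<in> V" and nj: "\<not> joined F u v" and "finite V"
  shows "Suc (card (joined_classes V (insert {u, v} F))) = card (joined_classes V F)"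
proof -
  let ?c = "\<lambda>x. {y \<in> V. joined F x y}"
  let ?C = "joined_classes V F"
  have fin: "finite ?C"
    using \<open>finite V\<close> by (simp add: joined_classes_def)
  have cls: "{y \<in> V. joined (insert {u, v} F) x y} =
      (if joined F x u \<or> joined F x v then ?c u \<union> ?c v else ?c x)" for x
  proof -
    have "joined (insert {u, v} F) x y \<longleftrightarrow>
        (if joined F x u \<or> joined F x v then joined F u y \<or> joined F v y else joined F x y)" for y
      unfolding joined_insert by (smt (verit) joined_sym joined_trans)
    then show ?thesis by auto
  qed
  have "joined_classes V (insert {u, v} F) = insert (?c u \<union> ?c v) (?C - {?c u, ?c v})"
  proof (intro equalityI subsetI)
    fix X assume "X \<in> joined_classes V (insert {u, v} F)"
    then obtain x where x: "x \<in> V" "X = {y \<in> V. joined (insert {u, v} F) x y}"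
      by (auto simp: joined_classes_def)
    show "X \<in> insert (?c u \<union> ?c v) (?C - {?c u, ?c v})"
    proof (cases "joined F x u \<or> joined F x v")
      case True
      then show ?thesis using x cls by simp
    next
      case False
      then have "X = ?c x" using x cls by simp
      then show ?thesis
        using False x V joined_class_eq_iff[of x V u F] joined_class_eq_iff[of x V v F]
        by (simp add: joined_classes_def)
    qed
  next
    fix X assume X: "X \<in> insert (?c u \<union> ?c v) (?C - {?c u, ?c v})"
    show "X \<in> joined_classes V (insert {u, v} F)"
    proof (cases "X = ?c u \<union> ?c v")
      case True
      then have "X = {y \<in> V. joined (insert {u, v} F) u y}"
        using cls[of u] by simp
      then show ?thesis
        using V by (auto simp: joined_classes_def)
    next
      case False
      then obtain x where x: "x \<in> V" "X = ?c x" "?c x \<noteq> ?c u" "?c x \<noteq> ?c v"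
        using X by (auto simp: joined_classes_def)
      then have "\<not> joined F x u" "\<not> joined F x v"
        using V joined_class_eq_iff[of x V u F] joined_class_eq_iff[of x V v F] by auto
      then have "X = {y \<in> V. joined (insert {u, v} F) x y}"
        using cls[of x] x by simp
      then show ?thesis
        using x by (auto simp: joined_classes_def)
    qed
  qed
  \<comment> \<open>The union is a genuinely new member, so two classes are lost and exactly one is
    gained.\<close>
  moreover have "?c u \<union> ?c v \<notin> ?C"
  proof
    assume "?c u \<union> ?c v \<in> ?C"
    then obtain x where x: "?c u \<union> ?c v = ?c x"
      unfolding joined_classes_def by blast
    have "u \<in> ?c x" "v \<in> ?c x"
      unfolding x[symmetric] using V by simp_all
    then have "joined F x u" "joined F x v"
      by simp_all
    then show False
      using nj by (meson joined_sym joined_trans)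
  qed
  ultimately have "card (joined_classes V (insert {u, v} F)) = Suc (card (?C - {?c u, ?c v}))"
    using fin by simp
  moreover have sub: "{?c u, ?c v} \<subseteq> ?C"
    using V by (auto simp: joined_classes_def)
  have "?c u \<noteq> ?c v"
    using nj V joined_class_eq_iff[of u V v F] by simp
  then have two: "card {?c u, ?c v} = 2"
    by (rule card_2_iff[THEN iffD2, OF exI, OF exI, OF conjI[OF refl]])
  have "card (?C - {?c u, ?c v}) = card ?C - 2"
    using card_Diff_subset[OF _ sub] two by simp
  moreover have "2 \<le> card ?C"
    using card_mono[OF fin sub] two by linarith
  ultimately show ?thesis
    by linarith
qed

section \<open>Forest packings and exchanges\<close>

definition forest_packing :: "'a set set \<Rightarrow> nat \<Rightarrow> (nat \<Rightarrow> 'a set set) \<Rightarrow> bool" where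
  "forest_packing E k F \<longleftrightarrow> (\<forall>i<k. F i \<subseteq> E \<and> edge_forest (F i)) \<and> disjoint_family_on F {..<k}"

text \<open>An exchange replaces the edge \<open>f\<close> of forest \<open>i\<close> by an edge
  \<open>{x, y}\<close> that all forests omit. The last premise keeps the result a forest; if forest
  \<open>i\<close> joins \<open>x\<close> and \<open>y\<close>, it says that \<open>f\<close> lies
  on its path between them.\<close>

inductive exchanges ::
    "'a set set \<Rightarrow> nat \<Rightarrow> (nat \<Rightarrow> 'a set set) \<Rightarrow> (nat \<Rightarrow> 'a set set) \<Rightarrow> bool"
  for E :: "'a set set" and k :: nat and F0 :: "nat \<Rightarrow> 'a set set" where
  base: "exchanges E k F0 F0"
| step: "exchanges E k F0 F \<Longrightarrow> i < k \<Longrightarrow> {x, y} \<in> E \<Longrightarrow> \<forall>j<k. {x, y} \<notin> F j \<Longrightarrow> f \<in> F i \<Longrightarrow>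
    \<not> joined (F i - {f}) x y \<Longrightarrow> exchanges E k F0 (F(i := insert {x, y} (F i - {f})))"

text \<open>For a maximum packing, the components of these edges form the partition at which the
  Nash-Williams--Tutte count is tight.\<close>

definition omittable :: "'a set set \<Rightarrow> nat \<Rightarrow> (nat \<Rightarrow> 'a set set) \<Rightarrow> 'a set set" where
  "omittable E k F0 = {e \<in> E. \<exists>F. exchanges E k F0 F \<and> (\<forall>i<k. e \<notin> F i)}"

lemma sum_card_fun_upd:
  fixes F :: "nat \<Rightarrow> 'a set"
  assumes "i < k"
  shows "(\<Sum>j<k. card ((F(i := A)) j)) + card (F i) = (\<Sum>j<k. card (F j)) + card A"
proof -
  have "(\<Sum>j\<in>{..<k} - {i}. card ((F(i := A)) j)) = (\<Sum>j\<in>{..<k} - {i}. card (F j))"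
    by (intro sum.cong) auto
  then show ?thesis
    using assms sum.remove[of "{..<k}" i "\<lambda>j. card (F j)"]
      sum.remove[of "{..<k}" i "\<lambda>j. card ((F(i := A)) j)"] by simp
qed

lemma forest_packing_fun_upd:
  assumes "forest_packing E k F" "i < k" "A \<subseteq> E" "edge_forest A"
    "\<And>j. j < k \<Longrightarrow> j \<noteq> i \<Longrightarrow> A \<inter> F j = {}"
  shows "forest_packing E k (F(i := A))"
  unfolding forest_packing_def disjoint_family_on_def
proof (intro conjI allI ballI impI)
  fix m n assume mn: "m \<in> {..<k}" "n \<in> {..<k}" "m \<noteq> n"
  then have "F m \<inter> F n = {}"
    using assms(1) by (simp add: forest_packing_def disjoint_family_on_def)
  then show "(F(i := A)) m \<inter> (F(i := A)) n = {}"
    using mn assms(5)[of m] assms(5)[of n] by (auto simp: Int_commute)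
qed (use assms in \<open>auto simp: forest_packing_def\<close>)

lemma mod_add_left_cancel_nat:
  fixes a b k m :: nat
  assumes "(m + a) mod k = (m + b) mod k" "a < k" "b < k"
  shows "a = b"
proof -
  have "a = b" if "a \<le> b" "(m + a) mod k = (m + b) mod k" "b < k" for a b
  proof -
    have "k dvd m + b - (m + a)"
      using that mod_eq_dvd_iff_nat[of "m + a" "m + b" k] by simp
    then show ?thesis
      using that by (auto dest: dvd_imp_le)
  qed
  then show ?thesis
    using assms by (metis nat_le_linear)
qed

text \<open>Packings and multicuts are treated for plain sets of two-element edges, where each edge
  is counted once, unlike the arcs of a symmetric digraph.\<close>

locale fin_edge_set =
  fixes V :: "'a set" and E :: "'a set set"
  assumes finite_V: "finite V"
    and edges: "e \<in> E \<Longrightarrow> \<exists>u\<in>V. \<exists>v\<in>V. u \<noteq> v \<and> e = {u, v}"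
begin

lemma finite_E: "finite E"
proof (rule finite_subset)
  show "E \<subseteq> Pow V" using edges by blast
qed (simp add: finite_V)

lemma subset: "F \<subseteq> E \<Longrightarrow> fin_edge_set V F"
  by unfold_locales (use finite_V edges in auto)

text \<open>Starting from singleton classes, each edge of a forest merges two distinct
  classes.\<close>

lemma edge_forest_card:
  assumes "edge_forest E"
  shows "card E + card (joined_classes V E) = card V"
proof -
  have "edge_forest F \<Longrightarrow> card F + card (joined_classes V F) = card V" if "F \<subseteq> E" for F
    using finite_subset[OF that finite_E] that
  proof (induction F rule: finite_induct)
    case empty
    have "joined {} x y \<longleftrightarrow> x = y" for x y :: 'a
      by (simp add: joined_def)
    then have "joined_classes V {} = (\<lambda>x. {x}) ` V"
      unfolding joined_classes_def by (intro image_cong) auto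
    then show ?case
      by (simp add: card_image)
  next
    case (insert e F)
    obtain u v where uv: "u \<in> V" "v \<in> V" "e = {u, v}"
      using insert.prems edges[of e] by auto
    have "\<not> joined F u v"
      using insert.prems(1) insert.hyps(2) uv(3) by (auto simp: edge_forest_def)
    then have "Suc (card (joined_classes V (insert e F))) = card (joined_classes V F)"
      using joined_classes_insert uv finite_V by simp
    moreover have "edge_forest F"
      using insert.prems(1) edge_forest_subset by blast
    ultimately show ?case
      using insert by simp
  qed
  then show ?thesis
    using assms by blast
qed


text \<open>Consequently every packing reached from a maximum one is again maximum, and maximality
  can be invoked after any sequence of exchanges.\<close>

lemma exchanges_invariant:
  assumes "exchanges E k F0 F" "forest_packing E k F0"
  shows "forest_packing E k F" "(\<Sum>i<k. card (F i)) = (\<Sum>i<k. card (F0 i))"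
proof -
  have "forest_packing E k F \<and> (\<Sum>i<k. card (F i)) = (\<Sum>i<k. card (F0 i))"
    using assms(1)
  proof induction
    case base
    then show ?case using assms(2) by simp
  next
    case (step F i x y f)
    let ?A = "insert {x, y} (F i - {f})"
    have F: "forest_packing E k F"
      using step.IH ..
    have Fi: "F i \<subseteq> E" "edge_forest (F i)"
      using F \<open>i < k\<close> by (auto simp: forest_packing_def)
    have "edge_forest ?A"
      using edge_forest_insert[OF edge_forest_subset[OF Fi(2)] step.hyps(6)] by auto
    moreover have "?A \<inter> F j = {}" if "j < k" "j \<noteq> i" for j
    proof -
      have "F i \<inter> F j = {}"
        using F \<open>i < k\<close> that by (simp add: forest_packing_def disjoint_family_on_def)
      then show ?thesis
        using step.hyps that by auto
    qed
    ultimately have "forest_packing E k (F(i := ?A))"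
      using Fi step.hyps F by (intro forest_packing_fun_upd) auto
    moreover have "card ?A = card (F i)"
      using step.hyps finite_subset[OF Fi(1) finite_E] card.remove[of "F i" f] by simp
    ultimately show ?case
      using sum_card_fun_upd[OF \<open>i < k\<close>, of F ?A] step.IH by (simp del: fun_upd_apply)
  qed
  then show "forest_packing E k F" "(\<Sum>i<k. card (F i)) = (\<Sum>i<k. card (F0 i))"
    by simp_all
qed

text \<open>If forest \<open>i\<close> did not join \<open>x\<close> and \<open>y\<close>, adding
  the edge would enlarge a maximum packing. Hence it contains a path between them, and each edge
  \<open>f\<close> of this path is omittable, since exchanging it for \<open>{x, y}\<close> leaves
  \<open>f\<close> in no forest.\<close>

lemma joined_omitted_edge:
  assumes max: "forest_packing E k F0"
      "\<And>F. forest_packing E k F \<Longrightarrow> (\<Sum>i<k. card (F i)) \<le> (\<Sum>i<k. card (F0 i))"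
    and F: "exchanges E k F0 F" and "i < k" and e: "{x, y} \<in> E" "\<forall>j<k. {x, y} \<notin> F j"
  shows "joined (F i \<inter> omittable E k F0) x y"
proof -
  have pack: "forest_packing E k F" and card: "(\<Sum>i<k. card (F i)) = (\<Sum>i<k. card (F0 i))"
    by (rule exchanges_invariant[OF F max(1)])+
  then have Fi: "F i \<subseteq> E" "edge_forest (F i)" and disj: "\<And>j. j < k \<Longrightarrow> j \<noteq> i \<Longrightarrow> F i \<inter> F j = {}"
    using \<open>i < k\<close> by (auto simp: forest_packing_def disjoint_family_on_def)
  have fin: "finite (F i)"
    by (rule finite_subset[OF Fi(1) finite_E])
  have "joined (F i) x y"
  proof (rule ccontr)
    assume "\<not> joined (F i) x y"
    then have "forest_packing E k (F(i := insert {x, y} (F i)))"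
      using e Fi disj pack \<open>i < k\<close> by (intro forest_packing_fun_upd edge_forest_insert) auto
    from max(2)[OF this] show False
      using sum_card_fun_upd[OF \<open>i < k\<close>, of F "insert {x, y} (F i)"] card e(2) fin \<open>i < k\<close>
      by simp
  qed
  moreover have "F i \<subseteq> {{u, v} |u v. True}"
    using edges[OF subsetD[OF Fi(1)]] by fast
  ultimately have path: "joined {f \<in> F i. \<not> joined (F i - {f}) x y} x y"
    by (intro edge_forest_path Fi(2) fin)
  have "f \<in> omittable E k F0" if f: "f \<in> F i" "\<not> joined (F i - {f}) x y" for f
  proof -
    let ?F = "F(i := insert {x, y} (F i - {f}))"
    have "exchanges E k F0 ?F"
      using F \<open>i < k\<close> e f by (rule exchanges.step)
    moreover have "\<forall>j<k. f \<notin> ?F j"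
    proof (intro allI impI)
      fix j assume "j < k"
      then show "f \<notin> ?F j"
        using f(1) e(2) \<open>i < k\<close> disj[of j] by (cases "j = i") auto
    qed
    ultimately show ?thesis
      using f(1) Fi(1) by (auto simp: omittable_def)
  qed
  then have "{f \<in> F i. \<not> joined (F i - {f}) x y} \<subseteq> F i \<inter> omittable E k F0"
    by blast
  then show ?thesis
    by (rule joined_mono[OF path])
qed

text \<open>
  An exchange adds to forest \<open>i\<close> only an omitted edge, whose ends are already joined by the omittable
  edges of that forest, so exchanges never enlarge these joined classes.
\<close>

lemma joined_exchanges:
  assumes max: "forest_packing E k F0"
      "\<And>F. forest_packing E k F \<Longrightarrow> (\<Sum>i<k. card (F i)) \<le> (\<Sum>i<k. card (F0 i))"
    and F: "exchanges E k F0 F" and "i < k" and "joined (F i \<inter> omittable E k F0) u v"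
  shows "joined (F0 i \<inter> omittable E k F0) u v"
  using F assms(5)
proof (induction arbitrary: u v)
  case (step F j x y f)
  show ?case
  proof (cases "j = i")
    case True
    have xy: "joined (F i \<inter> omittable E k F0) x y"
      using joined_omitted_edge[OF max step.hyps(1) \<open>i < k\<close> step.hyps(3,4)] .
    have "joined (F i \<inter> omittable E k F0) u v"
      using step.prems
    proof (rule joined_closure)
      fix a b assume "{a, b} \<in> (F(j := insert {x, y} (F j - {f}))) i \<inter> omittable E k F0"
      then consider "{a, b} = {x, y}" | "{a, b} \<in> F i \<inter> omittable E k F0"
        using True by auto
      then show "joined (F i \<inter> omittable E k F0) a b"
        by cases (use xy joined_sym in \<open>auto simp: doubleton_eq_iff intro: joined_edge\<close>)
    qed
    then show ?thesis
      by (rule step.IH)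
  next
    case False
    then show ?thesis
      using step by simp
  qed
qed

text \<open>For each omittable edge some reachable packing omits it. There forest \<open>i\<close>
  joins its ends by omittable edges, and this connection is carried back to \<open>F0 i\<close>.
  Thus \<open>F0 i\<close> restricted to the omittable edges spans their components.\<close>

lemma joined_omittable:
  assumes max: "forest_packing E k F0"
      "\<And>F. forest_packing E k F \<Longrightarrow> (\<Sum>i<k. card (F i)) \<le> (\<Sum>i<k. card (F0 i))"
    and "i < k"
  shows "joined (F0 i \<inter> omittable E k F0) x y \<longleftrightarrow> joined (omittable E k F0) x y"
proof
  assume "joined (omittable E k F0) x y"
  then show "joined (F0 i \<inter> omittable E k F0) x y"
  proof (rule joined_closure)
    fix u v assume "{u, v} \<in> omittable E k F0"
    then obtain F where F: "exchanges E k F0 F" and "{u, v} \<in> E" "\<forall>j<k. {u, v} \<notin> F j"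
      by (auto simp: omittable_def)
    then show "joined (F0 i \<inter> omittable E k F0) u v"
      using joined_exchanges[OF max F \<open>i < k\<close>] joined_omitted_edge[OF max F \<open>i < k\<close>] by blast
  qed
qed (erule joined_mono, simp)

section \<open>Disjoint spanning trees from edge-connectivity\<close>

lemma maximum_forest_packing:
  obtains F where "forest_packing E k F"
    "\<And>F'. forest_packing E k F' \<Longrightarrow> (\<Sum>i<k. card (F' i)) \<le> (\<Sum>i<k. card (F i))"
proof -
  have "forest_packing E k (\<lambda>_. {})"
    by (simp add: forest_packing_def edge_forest_def disjoint_family_on_def)
  moreover have "\<forall>F. forest_packing E k F \<longrightarrow> (\<Sum>i<k. card (F i)) < Suc (k * card E)"
  proof (intro allI impI)
    fix F assume "forest_packing E k F"
    then have "card (F i) \<le> card E" if "i < k" for i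
      using that by (intro card_mono finite_E) (simp add: forest_packing_def)
    then have "(\<Sum>i<k. card (F i)) \<le> (\<Sum>i<k. card E)"
      by (intro sum_mono) auto
    then show "(\<Sum>i<k. card (F i)) < Suc (k * card E)"
      by simp
  qed
  ultimately show ?thesis
    using ex_has_greatest_nat[of "forest_packing E k" _ "\<lambda>F. \<Sum>i<k. card (F i)"] that by blast
qed

text \<open>
  With at least two classes, each class is left by at least \<open>2 * k\<close> edges outside \<open>F\<close>, and each such
  edge leaves at most two classes.
\<close>

lemma card_cross_classes:
  assumes cut: "\<And>X. X \<noteq> {} \<Longrightarrow> X \<subset> V \<Longrightarrow> 2 * k \<le> card {e \<in> E. card (e \<inter> X) = 1}"
    and F: "F \<subseteq> E"
  shows "k * card (joined_classes V F) \<le> card (E - F) + k"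
\<comment> \<open>A single class is not a proper subset of \<open>V\<close>, so no cut bound is
  available; the summand \<open>k\<close> on the right covers this case.\<close>
proof (cases "card (joined_classes V F) \<le> 1")
  case True
  from mult_le_mono2[OF this, of k] show ?thesis
    by linarith
next
  case False
  let ?C = "joined_classes V F" and ?D = "E - F"
  have finC: "finite ?C"
    using finite_V by (simp add: joined_classes_def)
  have cutX: "2 * k \<le> card {e \<in> ?D. card (e \<inter> X) = 1}" if X: "X \<in> ?C" for X
  proof -
    obtain x where x: "x \<in> V" "X = {y \<in> V. joined F x y}"
      using X by (auto simp: joined_classes_def)
    have "X \<noteq> V"
    proof
      assume V: "X = V"
      have "?C = {V}"
      proof -
        have "{z \<in> V. joined F y z} = V" if "y \<in> V" for y
          using joined_class_eq_iff[OF x(1) that, of F] V x that by auto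
        then show ?thesis
          using x(1) by (auto simp: joined_classes_def)
      qed
      then show False
        using False by simp
    qed
    then have "2 * k \<le> card {e \<in> E. card (e \<inter> X) = 1}"
      using x by (intro cut) auto
    \<comment> \<open>An edge of \<open>F\<close> has both ends in the same class, so it never
      leaves \<open>X\<close>.\<close>
    also have "{e \<in> E. card (e \<inter> X) = 1} = {e \<in> ?D. card (e \<inter> X) = 1}"
    proof -
      have "card (e \<inter> X) \<noteq> 1" if e: "e \<in> F" for e
      proof -
        obtain u v where uv: "u \<in> V" "v \<in> V" "u \<noteq> v" "e = {u, v}"
          using edges e F by blast
        then have "joined F u v"
          using e by (auto intro: joined_edge)
        then have "u \<in> X \<longleftrightarrow> v \<in> X"
          using uv x by (auto dest: joined_trans joined_sym)
        then have "e \<inter> X = {} \<or> e \<inter> X = {u, v}"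
          using uv by auto
        then show ?thesis
          using uv by auto
      qed
      then show ?thesis by auto
    qed
    finally show ?thesis .
  qed
  have "2 * k * card ?C = (\<Sum>X\<in>?C. 2 * k)"
    by simp
  also have "\<dots> \<le> (\<Sum>X\<in>?C. card {e \<in> ?D. card (e \<inter> X) = 1})"
    by (intro sum_mono cutX)
  \<comment> \<open>Double counting of the pairs of a class and an edge leaving it.\<close>
  also have "\<dots> = (\<Sum>e\<in>?D. card {X \<in> ?C. card (e \<inter> X) = 1})"
    using finC finite_E by (intro sum_multicount_gen) auto
  also have "\<dots> \<le> (\<Sum>e\<in>?D. 2)"
  proof (rule sum_mono)
    fix e assume "e \<in> ?D"
    then obtain u v where uv: "u \<in> V" "v \<in> V" "u \<noteq> v" "e = {u, v}"
      using edges by blast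
    have "{X \<in> ?C. card (e \<inter> X) = 1} \<subseteq> {{y \<in> V. joined F u y}, {y \<in> V. joined F v y}}"
    proof
      fix X assume X: "X \<in> {X \<in> ?C. card (e \<inter> X) = 1}"
      then obtain x where x: "x \<in> V" "X = {y \<in> V. joined F x y}"
        by (auto simp: joined_classes_def)
      have "u \<in> X \<or> v \<in> X"
        using X uv by (cases "e \<inter> X = {}") auto
      then have "joined F x u \<or> joined F x v"
        using x by auto
      then show "X \<in> {{y \<in> V. joined F u y}, {y \<in> V. joined F v y}}"
        using joined_class_eq_iff[of x V u F] joined_class_eq_iff[of x V v F] x uv by auto
    qed
    then have "card {X \<in> ?C. card (e \<inter> X) = 1}
        \<le> card {{y \<in> V. joined F u y}, {y \<in> V. joined F v y}}"
      by (intro card_mono) auto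
    also have "\<dots> \<le> 2"
      by (simp add: card_insert_if)
    finally show "card {X \<in> ?C. card (e \<inter> X) = 1} \<le> 2" .
  qed
  finally show ?thesis
    by simp
qed

text \<open>Let the omittable edges of a maximum packing have \<open>p\<close> classes. Each forest
  has \<open>card V - p\<close> omittable edges, and the forests together use all other edges, of
  which there are at least \<open>k * (p - 1)\<close>. For non-empty \<open>V\<close> the total is
  therefore at least \<open>k * (card V - 1)\<close>, which forces every forest to be a spanning
  tree.\<close>

theorem spanning_tree_packing:
  assumes cut: "\<And>X. X \<noteq> {} \<Longrightarrow> X \<subset> V \<Longrightarrow> 2 * k \<le> card {e \<in> E. card (e \<inter> X) = 1}"
  obtains F where "forest_packing E k F" "\<And>i x y. i < k \<Longrightarrow> x \<in> V \<Longrightarrow> y \<in> V \<Longrightarrow> joined (F i) x y"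
proof -
  obtain F where pack: "forest_packing E k F" and
    max: "\<And>F'. forest_packing E k F' \<Longrightarrow> (\<Sum>i<k. card (F' i)) \<le> (\<Sum>i<k. card (F i))"
    using maximum_forest_packing by metis
  let ?O = "omittable E k F"
  let ?p = "card (joined_classes V ?O)"
  have OE: "?O \<subseteq> E"
    by (auto simp: omittable_def)
  have Fi: "F i \<subseteq> E" "edge_forest (F i)" "finite (F i)" if "i < k" for i
    using pack that finite_subset[OF _ finite_E] by (auto simp: forest_packing_def)
  have inO: "card (F i \<inter> ?O) + ?p = card V" if i: "i < k" for i
  proof -
    have "joined_classes V (F i \<inter> ?O) = joined_classes V ?O"
      by (intro joined_classes_cong joined_omittable[OF pack max i])
    moreover have "edge_forest (F i \<inter> ?O)"
      using Fi(2)[OF i] by (rule edge_forest_subset) simp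
    moreover have "fin_edge_set V (F i \<inter> ?O)"
      using OE by (intro subset) auto
    ultimately show ?thesis
      using fin_edge_set.edge_forest_card by metis
  qed
  have "(\<Sum>i<k. card (F i)) = (\<Sum>i<k. card (F i \<inter> ?O) + card (F i - ?O))"
    using Fi(3) by (intro sum.cong) (auto simp: card_Int_Diff)
  moreover have "(\<Sum>i<k. card (F i \<inter> ?O)) + k * ?p = k * card V"
  proof -
    have "(\<Sum>i<k. card (F i \<inter> ?O) + ?p) = (\<Sum>i<k. card V)"
      using inO by (intro sum.cong) auto
    then show ?thesis
      by (simp add: sum.distrib)
  qed
  moreover have "card (E - ?O) \<le> (\<Sum>i<k. card (F i - ?O))"
  proof -
    \<comment> \<open>\<open>F\<close> is reached by the empty sequence of exchanges, so an edge
      that \<open>F\<close> itself omits is omittable.\<close>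
    have "E - ?O \<subseteq> (\<Union>i<k. F i - ?O)"
      by (auto simp: omittable_def intro: exchanges.base)
    then have "card (E - ?O) \<le> card (\<Union>i<k. F i - ?O)"
      using Fi(3) by (intro card_mono) auto
    also have "\<dots> \<le> (\<Sum>i<k. card (F i - ?O))"
      by (intro card_UN_le) simp
    finally show ?thesis .
  qed
  ultimately have total: "k * card V \<le> (\<Sum>i<k. card (F i)) + k"
    using card_cross_classes[OF cut OE] by (simp add: sum.distrib)
  have comp: "card (F i) + card (joined_classes V (F i)) = card V" if "i < k" for i
    using fin_edge_set.edge_forest_card[OF subset] Fi that by blast
  show thesis
  proof (cases "V = {}")
    \<comment> \<open>Without vertices there are no classes, so the bound \<open>pos\<close> of the
      other case would fail; the joining claim is vacuous.\<close>
    case True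
    then show thesis
      using that pack by simp
  next
    case False
    then have pos: "1 \<le> card (joined_classes V A)" for A
      using finite_V by (simp add: joined_classes_def Suc_le_eq card_gt_0_iff)
    have one: "card (joined_classes V (F i)) = 1" if "i < k" for i
    proof (rule ccontr)
      assume "card (joined_classes V (F i)) \<noteq> 1"
      then have "card (F i) + 1 < card V"
        using comp[OF \<open>i < k\<close>] pos[of "F i"] by linarith
      moreover have "card (F j) + 1 \<le> card V" if "j < k" for j
        using comp[OF that] pos[of "F j"] by linarith
      \<comment> \<open>One forest with several components pushes the total strictly below the bound
        \<open>total\<close>.\<close>
      ultimately have "(\<Sum>j<k. card (F j) + 1) < (\<Sum>j<k. card V)"
        using \<open>i < k\<close> by (intro sum_strict_mono_ex1) auto
      then show False
        using total unfolding sum.distrib by simp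
    qed
    have "joined (F i) x y" if "i < k" "x \<in> V" "y \<in> V" for i x y
    proof -
      obtain C where C: "joined_classes V (F i) = {C}"
        using one[OF \<open>i < k\<close>] by (auto simp: card_1_singleton_iff)
      have "{z \<in> V. joined (F i) w z} = C" if "w \<in> V" for w
      proof -
        have "{z \<in> V. joined (F i) w z} \<in> joined_classes V (F i)"
          unfolding joined_classes_def using that by (rule imageI)
        then show ?thesis
          unfolding C by (rule singletonD)
      qed
      then show ?thesis
        using joined_class_eq_iff[OF that(2,3), of "F i"] that(2,3) by simp
    qed
    then show thesis
      using that pack by blast
  qed
qed

section \<open>Colourings with the most bichromatic edges\<close>

text \<open>For an edge, \<open>inj_on c e\<close> says that its ends have different colours. The
  \<open>k\<close> rotations of the colours on \<open>X\<close> make disjoint sets of cut edges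
  monochromatic, and maximality makes the set for rotation 0 a smallest one. It thus has at most a
  \<open>1/k\<close> share of the cut; the bound is multiplied by \<open>k\<close> to stay in the
  natural numbers.\<close>

lemma maximum_multicut:
  assumes "0 < k"
  obtains c :: "'a \<Rightarrow> nat" where "\<And>v. c v < k"
    "\<And>X. (k - 1) * card {e \<in> E. card (e \<inter> X) = 1}
      \<le> k * card {e \<in> {e \<in> E. inj_on c e}. card (e \<inter> X) = 1}"
proof -
  have "card {e \<in> E. inj_on c e} < Suc (card E)" for c :: "'a \<Rightarrow> nat"
    using finite_E by (simp add: card_mono less_Suc_eq_le)
  then obtain c :: "'a \<Rightarrow> nat" where c: "\<forall>v. c v < k" and
    max: "\<And>c'. \<forall>v. c' v < k \<Longrightarrow> card {e \<in> E. inj_on c' e} \<le> card {e \<in> E. inj_on c e}"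
    using ex_has_greatest_nat[of "\<lambda>c. \<forall>v. c v < k" "\<lambda>_. 0" "\<lambda>c. card {e \<in> E. inj_on c e}"
        "Suc (card E)"] assms by blast
  have "(k - 1) * card {e \<in> E. card (e \<inter> X) = 1}
      \<le> k * card {e \<in> {e \<in> E. inj_on c e}. card (e \<inter> X) = 1}" for X
  proof -
    let ?D = "{e \<in> E. card (e \<inter> X) = 1}"
    \<comment> \<open>\<open>M s\<close> is the set of cut edges that become monochromatic when the colours on \<open>X\<close> rotate by \<open>s\<close>;
      each cut edge belongs to only one of these sets.\<close>
    define sh where "sh s v = (if v \<in> X then (c v + s) mod k else c v)" for s v
    define M where "M s = {e \<in> ?D. \<not> inj_on (sh s) e}" for s
    have finD: "finite ?D" and finM: "\<And>s. finite (M s)"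
      using finite_E by (simp_all add: M_def)
    have subM: "M s \<subseteq> ?D" for s
      by (auto simp: M_def)
    have sh0: "sh 0 = c"
      using c by (auto simp: sh_def fun_eq_iff)
    \<comment> \<open>Rotation moves both ends or neither end of an edge outside the cut, so only
      cut edges can change their status.\<close>
    have shifted: "card {e \<in> E. inj_on (sh s) e} + card (M s)
        = card {e \<in> E. inj_on c e \<and> card (e \<inter> X) \<noteq> 1} + card ?D" for s
    proof -
      have "inj_on (sh s) e \<longleftrightarrow> inj_on c e" if e: "e \<in> E" "card (e \<inter> X) \<noteq> 1" for e
      proof -
        obtain u v where uv: "u \<noteq> v" "e = {u, v}"
          using edges e(1) by blast
        have "u \<in> X \<longleftrightarrow> v \<in> X"
          using e(2) uv by (auto simp: Int_insert_left split: if_splits)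
        then have "sh s u = sh s v \<longleftrightarrow> c u = c v"
          using mod_add_left_cancel_nat[of s "c u" k "c v"] c by (auto simp: sh_def add.commute)
        then show ?thesis
          using uv by (auto simp: inj_on_def)
      qed
      then have "{e \<in> E. inj_on (sh s) e}
          = {e \<in> E. inj_on c e \<and> card (e \<inter> X) \<noteq> 1} \<union> (?D - M s)"
        by (auto simp: M_def)
      then have "card {e \<in> E. inj_on (sh s) e}
          = card {e \<in> E. inj_on c e \<and> card (e \<inter> X) \<noteq> 1} + card (?D - M s)"
        using finite_E by (simp only:) (intro card_Un_disjoint, auto)
      moreover have "card (?D - M s) + card (M s) = card ?D"
        using card_Diff_subset[OF finM subM] card_mono[OF finD subM] by simp
      ultimately show ?thesis
        by linarith
    qed
    have least: "card (M 0) \<le> card (M s)" for s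
    proof -
      have "\<forall>v. sh s v < k"
        using c assms by (simp add: sh_def)
      then show ?thesis
        using max[of "sh s"] shifted[of s] shifted[of 0] sh0 by simp
    qed
    have "disjoint_family_on M {..<k}"
      unfolding disjoint_family_on_def
    proof (intro ballI impI equals0I)
      fix s t e assume st: "s \<in> {..<k}" "t \<in> {..<k}" "s \<noteq> t" and e: "e \<in> M s \<inter> M t"
      then have "e \<in> E"
        by (simp add: M_def)
      then obtain u v where uv: "e = {u, v}" "u \<noteq> v"
        using edges by blast
      have "card (e \<inter> X) = 1"
        using e by (simp add: M_def)
      then have one: "u \<in> X \<longleftrightarrow> v \<notin> X"
        using uv by (auto simp: Int_insert_left split: if_splits)
      have "sh s u = sh s v" "sh t u = sh t v"
        using e uv by (auto simp: M_def)
      \<comment> \<open>Under both rotations the end in \<open>X\<close> receives the unchanged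
        colour of the other end, but distinct rotations below \<open>k\<close> give it distinct
        colours.\<close>
      then have "(c u + s) mod k = (c u + t) mod k \<or> (c v + s) mod k = (c v + t) mod k"
        using one by (cases "u \<in> X") (simp_all add: sh_def)
      then show False
        using mod_add_left_cancel_nat[of _ s k t] st by auto
    qed
    then have "(\<Sum>s<k. card (M s)) = card (\<Union>s<k. M s)"
      using finM by (simp add: card_UN_disjoint' )
    also have "\<dots> \<le> card ?D"
      by (intro card_mono finD UN_least subM)
    finally have "k * card (M 0) \<le> card ?D"
      using sum_mono[of "{..<k}" "\<lambda>_. card (M 0)" "\<lambda>s. card (M s)"] least by simp
    moreover have "{e \<in> {e \<in> E. inj_on c e}. card (e \<inter> X) = 1} = ?D - M 0"
      by (auto simp: M_def sh0)
    moreover have "card (?D - M 0) = card ?D - card (M 0)"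
      by (rule card_Diff_subset[OF finM subM])
    ultimately show ?thesis
      by (simp add: diff_mult_distrib diff_mult_distrib2)
  qed
  then show thesis
    using that c by blast
qed

end

section \<open>Translation to digraphs and spanning trees\<close>

text \<open>Arcs are selected by their underlying edge, so an arc and its reverse stay or go
  together and symmetry survives.\<close>

definition restrict_edges :: "('a, 'b) pre_digraph \<Rightarrow> 'a set set \<Rightarrow> ('a, 'b) pre_digraph" where
  "restrict_edges G F = G\<lparr>arcs := {a \<in> arcs G. {tail G a, head G a} \<in> F}\<rparr>"

lemma restrict_edges_simps [simp]:
  "verts (restrict_edges G F) = verts G"
  "tail (restrict_edges G F) = tail G"
  "head (restrict_edges G F) = head G"
  "arcs (restrict_edges G F) = {a \<in> arcs G. {tail G a, head G a} \<in> F}"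
  by (simp_all add: restrict_edges_def)

lemma uedges_restrict_edges: "F \<subseteq> uedges G \<Longrightarrow> uedges (restrict_edges G F) = F"
  by (auto simp: uedges_def)

lemma graph_restrict_edges:
  assumes "graph G"
  shows "graph (restrict_edges G F)"
proof -
  interpret graph G by fact
  show ?thesis
  proof unfold_locales
    show "symmetric (restrict_edges G F)"
      using sym_arcs unfolding symmetric_conv by (fastforce simp: insert_commute)
  qed (auto dest: no_loops intro: no_multi_arcs simp: arc_to_ends_def)
qed

lemma spanning_restrict_edges:
  assumes "graph G"
  shows "spanning (restrict_edges G F) G"
    and "F \<subseteq> F' \<Longrightarrow> spanning (restrict_edges G F) (restrict_edges G F')"
proof -
  have wf: "wf_digraph H" if "graph H" for H :: "('a, 'b) pre_digraph"
    using that by (simp add: graph_def digraph_def fin_digraph_def)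
  show "spanning (restrict_edges G F) G"
    and "F \<subseteq> F' \<Longrightarrow> spanning (restrict_edges G F) (restrict_edges G F')"
    using wf[OF assms] wf[OF graph_restrict_edges[OF assms]]
    by (auto simp: spanning_def subgraph_def compatible_def)
qed

text \<open>The condition on the arcs is separate from the digraph, so \<open>F\<close> may be
  smaller than the edge set in which the walk lives; this allows an edge avoided by the walk to be
  deleted.\<close>

lemma joined_if_cas:
  "pre_digraph.cas G x p y \<Longrightarrow> (\<And>a. a \<in> set p \<Longrightarrow> {tail G a, head G a} \<in> F) \<Longrightarrow> joined F x y"
proof (induction p arbitrary: x)
  case Nil
  then show ?case by (simp add: pre_digraph.cas.simps)
next
  case (Cons a p)
  then have "joined F (head G a) y" "tail G a = x"
    by (simp_all add: pre_digraph.cas.simps)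
  moreover have "{tail G a, head G a} \<in> F"
    using Cons.prems(2) by simp
  ultimately show ?case
    using joined_edge joined_trans by metis
qed

lemma connected_restrict_edges:
  assumes "graph G" "verts G \<noteq> {}" "F \<subseteq> uedges G"
    and joined: "\<And>x y. x \<in> verts G \<Longrightarrow> y \<in> verts G \<Longrightarrow> joined F x y"
  shows "connected (restrict_edges G F)"
proof -
  let ?T = "restrict_edges G F"
  interpret T: graph ?T
    using assms(1) by (rule graph_restrict_edges)
  have adj: "u \<rightarrow>\<^bsub>?T\<^esub> v" if uv: "{u, v} \<in> F" for u v
  proof -
    have "{u, v} \<in> uedges ?T"
      using uv uedges_restrict_edges[OF assms(3)] by simp
    then obtain a where "a \<in> arcs ?T" "{u, v} = {tail ?T a, head ?T a}"
      by (auto simp: uedges_def)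
    then have "u \<rightarrow>\<^bsub>?T\<^esub> v \<or> v \<rightarrow>\<^bsub>?T\<^esub> u"
      using T.in_arcs_imp_in_arcs_ends[of a] by (auto simp only: doubleton_eq_iff)
    then show ?thesis
      using T.graph_symmetric by blast
  qed
  have reach: "u \<rightarrow>\<^sup>*\<^bsub>?T\<^esub> v" if "joined F u v" "u \<in> verts ?T" for u v
    using that(1)
  proof (induction rule: joined_induct)
    case refl
    then show ?case using that(2) by (rule T.reachable_refl)
  next
    case (step v w)
    then show ?case using adj T.reachable_adj_trans by blast
  qed
  show ?thesis
    unfolding connected_def
  \<comment> \<open>\<open>connected\<close> means strong connectivity of the symmetric closure,
    which includes having a vertex; reachability in \<open>?T\<close> carries over to the
    closure.\<close>
  proof (rule strongly_connectedI)
    fix u v assume "u \<in> verts (with_proj (mk_symmetric ?T))" "v \<in> verts (with_proj (mk_symmetric ?T))"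
    then have "u \<in> verts G" "v \<in> verts G"
      by simp_all
    then show "u \<rightarrow>\<^sup>*\<^bsub>with_proj (mk_symmetric ?T)\<^esub> v"
      by (intro T.reachable_mk_symmetricI reach joined) simp_all
  qed (use assms(2) in simp)
qed

text \<open>In a cycle of length at least 3, the arcs after the first form a detour from its head
  back to its tail that avoids the underlying edge, so this edge is not a bridge.\<close>

lemma no_cycle_restrict_edges:
  assumes "graph G" "edge_forest F" "pre_digraph.cycle (restrict_edges G F) p"
  shows "length p < 3"
proof (rule ccontr)
  let ?T = "restrict_edges G F"
  interpret T: graph ?T
    using assms(1) by (rule graph_restrict_edges)
  assume "\<not> length p < 3"
  then obtain a b q where p: "p = a # b # q" "q \<noteq> []"
    by (cases p; cases "tl p") (auto simp: Suc_le_eq)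
  obtain u where walk: "T.awalk u p u" and dist: "distinct (tl (T.awalk_verts u p))"
    using assms(3) by (auto simp: T.cycle_def)
  let ?v = "head G a" and ?w = "head G b"
  have a: "a \<in> arcs ?T" "tail G a = u" and b: "b \<in> arcs ?T" "tail G b = ?v"
    and q: "T.awalk ?w q u"
    using walk p by (auto simp: T.awalk_Cons_iff)
  have v: "?v \<notin> set (T.awalk_verts ?w q)" and path: "T.apath ?w q u"
    using dist p b q by (auto simp: T.apath_def)
  \<comment> \<open>This is where length at least 3 enters: with \<open>q\<close> empty,
    \<open>b\<close> could be the reverse of \<open>a\<close>.\<close>
  have "?w \<noteq> u"
    using T.apath_nonempty_ends[OF path p(2)] .
  moreover have "?v \<noteq> u"
    using a T.no_loops[of a] by auto
  ultimately have nb: "{tail G b, head G b} \<noteq> {u, ?v}"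
    using b by (auto simp: doubleton_eq_iff)
  \<comment> \<open>The cycle does not revisit \<open>?v\<close>, so no arc of \<open>q\<close> has
    \<open>?v\<close> as an end.\<close>
  have nq: "{tail G e, head G e} \<noteq> {u, ?v}" if "e \<in> set q" for e
    using v that T.awalk_verts_arc1[OF that, of ?w] T.awalk_verts_arc2[OF q that]
    by (auto simp: doubleton_eq_iff)
  have arcs: "set (b # q) \<subseteq> arcs ?T" and cas: "T.cas ?v (b # q) u"
    using walk p by (auto simp: T.awalk_def)
  from cas have detour: "joined (F - {{u, ?v}}) ?v u"
  proof (rule joined_if_cas)
    fix e assume e: "e \<in> set (b # q)"
    then have "{tail G e, head G e} \<in> F"
      using arcs by auto
    moreover have "{tail G e, head G e} \<noteq> {u, ?v}"
      using e nb nq by (cases "e = b") simp_all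
    ultimately show "{tail ?T e, head ?T e} \<in> F - {{u, ?v}}"
      by simp
  qed
  have "{u, ?v} \<in> F"
    using a by auto
  then show False
    using assms(2) joined_sym[OF detour] by (simp add: edge_forest_def)
qed

lemma undirected_spanning_tree_restrict_edges:
  assumes "graph G" "verts G \<noteq> {}" "F \<subseteq> F'" "F' \<subseteq> uedges G" "edge_forest F"
    and "\<And>x y. x \<in> verts G \<Longrightarrow> y \<in> verts G \<Longrightarrow> joined F x y"
  shows "undirected_spanning_tree (restrict_edges G F) (restrict_edges G F')"
proof -
  have "F \<subseteq> uedges G"
    using assms(3,4) by simp
  then show ?thesis
    unfolding undirected_spanning_tree_def undirected_tree_def
    using graph_restrict_edges[OF assms(1)] spanning_restrict_edges(2)[OF assms(1,3)]
      connected_restrict_edges[OF assms(1,2) _ assms(6)]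
      no_cycle_restrict_edges[OF assms(1,5)] by (auto simp: not_less[symmetric])
qed

lemma fin_edge_set_graph:
  assumes "graph G"
  shows "fin_edge_set (verts G) (uedges G)"
proof -
  interpret graph G by fact
  show ?thesis
  proof
    fix e assume "e \<in> uedges G"
    then obtain a where "a \<in> arcs G" "e = {tail G a, head G a}"
      by (auto simp: uedges_def)
    then show "\<exists>u\<in>verts G. \<exists>v\<in>verts G. u \<noteq> v \<and> e = {u, v}"
      using no_loops[of a] by (intro bexI[of _ "tail G a"] bexI[of _ "head G a"]) simp_all
  qed simp
qed

section \<open>Spanning k-partite 2T-subgraphs\<close>

text \<open>The bichromatic part of a cut has at least a \<open>(k - 1) / k\<close> share of its
  \<open>m\<close> or more edges. The bound \<open>3 * k < (k - 1) * m\<close> makes this more than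
  3 edges, hence the 4 that two disjoint spanning trees require.\<close>

lemma spanning_k_partite_2T_subgraph:
  assumes G: "graph G" "verts G \<noteq> {}"
    and conn: "enat m \<le> edge_connectivity G" and "0 < k" and m: "3 * k < (k - 1) * m"
  shows "\<exists>H. spanning_2T_subgraph H G \<and> k_partite k H"
proof -
  interpret fin_edge_set "verts G" "uedges G"
    using G(1) by (rule fin_edge_set_graph)
  obtain c :: "'a \<Rightarrow> nat" where c: "\<And>v. c v < k" and
    cut: "\<And>X. (k - 1) * card {e \<in> uedges G. card (e \<inter> X) = 1}
      \<le> k * card {e \<in> {e \<in> uedges G. inj_on c e}. card (e \<inter> X) = 1}"
    using maximum_multicut[OF \<open>0 < k\<close>] by blast
  define D where "D = {e \<in> uedges G. inj_on c e}"
  have "2 * 2 \<le> card {e \<in> D. card (e \<inter> X) = 1}" if X: "X \<noteq> {}" "X \<subset> verts G" for X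
  proof -
    have "enat m \<le> enat (card (edge_cut G X))"
      using conn X unfolding edge_connectivity_def le_INF_iff by blast
    then have "(k - 1) * m \<le> (k - 1) * card {e \<in> uedges G. card (e \<inter> X) = 1}"
      by (simp add: edge_cut_def)
    then have "k * 3 < k * card {e \<in> D. card (e \<inter> X) = 1}"
      using m cut[of X] unfolding D_def by linarith
    then show ?thesis
      by simp
  qed
  moreover have "fin_edge_set (verts G) D"
    by (intro subset) (auto simp: D_def)
  ultimately obtain F where pack: "forest_packing D 2 F" and
    joined: "\<And>i x y. i < 2 \<Longrightarrow> x \<in> verts G \<Longrightarrow> y \<in> verts G \<Longrightarrow> joined (F i) x y"
    using fin_edge_set.spanning_tree_packing[of "verts G" D 2] by blast
  have F: "F i \<subseteq> D" "edge_forest (F i)" if "i < 2" for i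
    using pack that by (auto simp: forest_packing_def)
  have disj: "F 0 \<inter> F 1 = {}"
    using pack by (simp add: forest_packing_def disjoint_family_on_def)
  \<comment> \<open>Only the edges of the two trees are kept, so they decompose \<open>?H\<close>
    exactly; all of them are bichromatic, which makes the colour classes independent.\<close>
  let ?F = "F 0 \<union> F 1"
  let ?H = "restrict_edges G ?F"
  have FD: "?F \<subseteq> D"
    using F(1)[of 0] F(1)[of 1] by simp
  then have FG: "?F \<subseteq> uedges G"
    by (auto simp: D_def)
  have "undirected_spanning_tree (restrict_edges G (F i)) ?H" if "i = 0 \<or> i = 1" for i
    using that F joined by (intro undirected_spanning_tree_restrict_edges G FG) auto
  moreover have "uedges (restrict_edges G (F i)) = F i" if "i = 0 \<or> i = 1" for i
    using that FG by (intro uedges_restrict_edges) auto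
  ultimately have "graph_2T ?H"
    unfolding graph_2T_def using graph_restrict_edges[OF G(1)] uedges_restrict_edges[OF FG] disj
    by (intro conjI exI[of _ "restrict_edges G (F 0)"] exI[of _ "restrict_edges G (F 1)"]) auto
  moreover have "k_partite k ?H"
    unfolding k_partite_def
  proof (intro exI conjI allI impI)
    let ?P = "\<lambda>i. {v \<in> verts G. c v = i}"
    show "disjoint_family_on ?P {..<k}"
      by (auto simp: disjoint_family_on_def)
    show "(\<Union>i<k. ?P i) = verts ?H"
      using c by auto
    fix i
    have "\<not> e \<subseteq> ?P i" if e: "e \<in> ?F" for e
    proof -
      have "e \<in> uedges G" "inj_on c e"
        using e FD by (auto simp: D_def)
      moreover from this obtain u v where "e = {u, v}" "u \<noteq> v"
        using edges by blast
      ultimately show ?thesis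
        by auto
    qed
    then show "independent_set ?H (?P i)"
      unfolding independent_set_def uedges_restrict_edges[OF FG] by auto
  qed
  ultimately show ?thesis
    unfolding spanning_2T_subgraph_def using spanning_restrict_edges(1)[OF G(1)] by blast
qed

text \<open>The thresholds 5 and 7 are the least \<open>m\<close> with
  \<open>3 * k < (k - 1) * m\<close> for \<open>k = 3\<close> and \<open>k = 2\<close>:
  \<open>9 < 10\<close> and \<open>6 < 7\<close>.\<close>

theorem corollary1p5:
  fixes G :: "('a, 'b) pre_digraph"
  assumes "graph G" and "verts G \<noteq> {}"
  shows "(edge_connectivity G \<ge> 5 \<longrightarrow> (\<exists>H. spanning_2T_subgraph H G \<and> k_partite 3 H)) \<and>
         (edge_connectivity G \<ge> 7 \<longrightarrow> (\<exists>H. spanning_2T_subgraph H G \<and> bipartite H))"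
  using spanning_k_partite_2T_subgraph[OF assms, of 5 3]
    spanning_k_partite_2T_subgraph[OF assms, of 7 2]
  by (simp add: numeral_eq_enat)

end
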